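(* Let $B\in\mathcal{PC}_{n-1}$. Then there is $A\in\mathcal{PC}_n$ with $A(n)=B$ such that the Perron vector of $A$ is efficient for $A$.
   Context: $n\ge 2$. $\mathcal{PC}_n$ denotes the set of $n\times n$ reciprocal matrices, i.e. real matrices $A=[a_{ij}]$ with all entries positive and $a_{ji}=1/a_{ij}$ for all $i,j$ (so $a_{ii}=1$). The Perron vector of a positive square matrix is any entrywise positive (right) eigenvector (unique up to positive scalar multiple). $A(n)$ is the principal submatrix of $A$ obtained by deleting row and column $n$. A positive vector $w$ is efficient for $A\in\mathcal{PC}_n$ if, for every positive $n$-vector $v$, the inequalities $|a_{ij}-v_i/v_j|\le|a_{ij}-w_i/w_j|$ for all $i,j$ imply that $v$ is a positive scalar multiple of $w$. *)

theory Defs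
  imports Complex_Main "Jordan_Normal_Form.Char_Poly"
begin

definition reciprocal_mats :: "nat \<Rightarrow> real mat set" where
  "reciprocal_mats n = {A \<in> carrier_mat n n.
     \<forall>i<n. \<forall>j<n. A $$ (i, j) > 0 \<and> A $$ (j, i) = 1 / A $$ (i, j)}"

definition positive_vecs :: "nat \<Rightarrow> real vec set" where
  "positive_vecs n = {v \<in> carrier_vec n. \<forall>i<n. v $ i > 0}"

definition perron_vector :: "real mat \<Rightarrow> real vec \<Rightarrow> bool" where
  "perron_vector A w \<longleftrightarrow>
     w \<in> positive_vecs (dim_row A) \<and> (\<exists>r. eigenvector A w r)"

definition efficient :: "real mat \<Rightarrow> real vec \<Rightarrow> bool" where
  "efficient A w \<longleftrightarrow>
     w \<in> positive_vecs (dim_row A) \<and>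
     (\<forall>v \<in> positive_vecs (dim_row A).
        (\<forall>i<dim_row A. \<forall>j<dim_row A.
           \<bar>A $$ (i, j) - v $ i / v $ j\<bar> \<le> \<bar>A $$ (i, j) - w $ i / w $ j\<bar>)
        \<longrightarrow> (\<exists>c>0. v = c \<cdot>\<^sub>v w))"

end

theory Submission
  imports Defs
begin

text \<open>
  Write \<open>m = n - 1\<close> and extend a column \<open>u\<close> of \<open>B\<close> (here the one with index \<open>0\<close>) by a last
  entry \<open>1\<close> to a vector \<open>w\<close>. The new column of \<open>A\<close> is then chosen so that \<open>w\<close> is an eigenvector.
  Put \<open>y\<^sub>i = (B u)\<^sub>i / u\<^sub>i\<close>. The eigenvalue equation \<open>A w = (s + 1) w\<close> forces, in row \<open>i < m\<close>, the
  new entry \<open>(s + 1 - y\<^sub>i) u\<^sub>i\<close>; with reciprocity the last row becomes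
  \<open>(\<Sum>i<m. 1 / (s + 1 - y\<^sub>i)) = s\<close>, and this scalar equation has a solution beyond all the poles
  (\<open>exists_root_beyond_poles\<close>), which makes the new entries positive.

  Efficiency comes from the comparison digraph with an edge from \<open>i\<close> to \<open>j\<close> whenever
  \<open>w\<^sub>i / w\<^sub>j \<ge> a\<^sub>i\<^sub>j\<close>: along an edge, a vector \<open>v\<close> at least as good as \<open>w\<close> must satisfy
  \<open>v\<^sub>i / w\<^sub>i \<le> v\<^sub>j / w\<^sub>j\<close>, so strong connectivity makes \<open>v\<close> proportional to \<open>w\<close>
  (\<open>efficient_if_strongly_connected\<close>). Because \<open>u\<close> is a column of \<open>B\<close>, the ratios \<open>u\<^sub>i / u\<^sub>0\<close> match
  \<open>b\<^sub>i\<^sub>0\<close> exactly, and every old vertex is joined to vertex \<open>0\<close> in both directions. The new vertex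
  has an edge from \<open>i\<close> if \<open>y\<^sub>i \<ge> s\<close> and to \<open>i\<close> if \<open>y\<^sub>i \<le> s\<close>, so it remains to find both kinds of
  \<open>i\<close>. This is where \<open>y\<^sub>0 = m\<close> enters: if all \<open>y\<^sub>i < s\<close>, every summand above is below \<open>1\<close>, so
  \<open>s < m = y\<^sub>0\<close>; if all \<open>y\<^sub>i > s\<close>, every summand exceeds \<open>1\<close>, so \<open>s > m = y\<^sub>0\<close>. Both are absurd.

  Positive eigenvectors of a positive matrix are unique up to scaling
  (\<open>perron_vector_unique\<close>), so efficiency of \<open>w\<close> is efficiency of every Perron vector.
\<close>

section \<open>Efficiency and the comparison digraph\<close>

lemma ratio_le_if_better_on_edge:
  fixes a :: real
  assumes pos: "vi > 0" "vj > 0" "wi > 0" "wj > 0"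
    and edge: "a \<le> wi / wj"
    and better: "\<bar>a - vi / vj\<bar> \<le> \<bar>a - wi / wj\<bar>"
  shows "vi / wi \<le> vj / wj"
proof -
  have "vi / vj \<le> wi / wj"
    using edge better by linarith
  then show ?thesis
    using pos by (simp add: field_simps)
qed

text \<open>
  The ratios \<open>v\<^sub>i / w\<^sub>i\<close> cannot decrease along edges, so they are constant on a strongly connected
  digraph.
\<close>

lemma efficient_if_strongly_connected:
  assumes w: "w \<in> positive_vecs (dim_row A)"
    and conn: "\<And>i j. i < dim_row A \<Longrightarrow> j < dim_row A \<Longrightarrow>
      (i, j) \<in> {(i, j). i < dim_row A \<and> j < dim_row A \<and> A $$ (i, j) \<le> w $ i / w $ j}\<^sup>*"
  shows "efficient A w"
  unfolding efficient_def
proof (intro conjI ballI impI)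
  let ?n = "dim_row A"
  fix v
  assume v: "v \<in> positive_vecs ?n"
    and better: "\<forall>i<?n. \<forall>j<?n.
      \<bar>A $$ (i, j) - v $ i / v $ j\<bar> \<le> \<bar>A $$ (i, j) - w $ i / w $ j\<bar>"
  have mono: "v $ i / w $ i \<le> v $ j / w $ j" if "i < ?n" "j < ?n" for i j
    using conn[OF that]
  proof (induction rule: rtrancl_induct)
    case base
    then show ?case by simp
  next
    case (step k l)
    then have kl: "k < ?n" "l < ?n" and edge: "A $$ (k, l) \<le> w $ k / w $ l" by auto
    have "v $ k / w $ k \<le> v $ l / w $ l"
    proof (rule ratio_le_if_better_on_edge)
      show "A $$ (k, l) \<le> w $ k / w $ l" by (fact edge)
      show "\<bar>A $$ (k, l) - v $ k / v $ l\<bar> \<le> \<bar>A $$ (k, l) - w $ k / w $ l\<bar>"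
        using better kl by blast
    qed (use v w kl in \<open>auto simp: positive_vecs_def\<close>)
    with step.IH show ?case by linarith
  qed
  show "\<exists>c>0. v = c \<cdot>\<^sub>v w"
  proof (cases "?n = 0")
    case True
    then show ?thesis
      using v w by (intro exI[of _ 1]) (auto simp: positive_vecs_def)
  next
    case False
    have "v = (v $ 0 / w $ 0) \<cdot>\<^sub>v w"
    proof (rule eq_vecI)
      fix i
      assume "i < dim_vec ((v $ 0 / w $ 0) \<cdot>\<^sub>v w)"
      then have i: "i < ?n" using w by (auto simp: positive_vecs_def)
      have "v $ i / w $ i = v $ 0 / w $ 0"
        using mono[of i 0] mono[of 0 i] i False by simp
      moreover have "w $ i > 0" using w i by (simp add: positive_vecs_def)
      ultimately show "v $ i = ((v $ 0 / w $ 0) \<cdot>\<^sub>v w) $ i"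
        using w i by (auto simp: positive_vecs_def field_simps)
    qed (use v w in \<open>auto simp: positive_vecs_def\<close>)
    moreover have "v $ 0 / w $ 0 > 0"
      using v w False by (simp add: positive_vecs_def)
    ultimately show ?thesis by blast
  qed
qed (fact w)

lemma efficient_smult:
  assumes eff: "efficient A w" and c: "c > 0"
  shows "efficient A (c \<cdot>\<^sub>v w)"
  unfolding efficient_def
proof (intro conjI ballI impI)
  let ?n = "dim_row A"
  have w: "w \<in> positive_vecs ?n" using eff by (simp add: efficient_def)
  then show "c \<cdot>\<^sub>v w \<in> positive_vecs ?n"
    using c by (auto simp: positive_vecs_def)
  fix v
  assume v: "v \<in> positive_vecs ?n"
    and better: "\<forall>i<?n. \<forall>j<?n.
      \<bar>A $$ (i, j) - v $ i / v $ j\<bar> \<le> \<bar>A $$ (i, j) - (c \<cdot>\<^sub>v w) $ i / (c \<cdot>\<^sub>v w) $ j\<bar>"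
  have "(c \<cdot>\<^sub>v w) $ i / (c \<cdot>\<^sub>v w) $ j = w $ i / w $ j" if "i < ?n" "j < ?n" for i j
    using w c that by (auto simp: positive_vecs_def)
  with better eff v obtain d where "d > 0" "v = d \<cdot>\<^sub>v w"
    unfolding efficient_def by auto
  with c show "\<exists>e>0. v = e \<cdot>\<^sub>v (c \<cdot>\<^sub>v w)"
    by (intro exI[of _ "d / c"]) (simp add: smult_smult_assoc)
qed

section \<open>Uniqueness of Perron vectors\<close>

lemma eigenvector_row_sum:
  assumes "A \<in> carrier_mat n n" and "eigenvector A w r" and "i < n"
  shows "(\<Sum>j<n. A $$ (i, j) * w $ j) = r * w $ i"
proof -
  have w: "w \<in> carrier_vec n" and eq: "A *\<^sub>v w = r \<cdot>\<^sub>v w"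
    using assms by (auto simp: eigenvector_def)
  have "(A *\<^sub>v w) $ i = (r \<cdot>\<^sub>v w) $ i" using eq by simp
  then show ?thesis
    using assms(1,3) w by (simp add: scalar_prod_def atLeast0LessThan)
qed

text \<open>
  Compare the two vectors in a row \<open>k\<close> where \<open>v\<^sub>k / w\<^sub>k\<close> is largest: there \<open>v\<close> touches its majorant
  \<open>c w\<close>, while in every other coordinate it can only lie below it.
\<close>

lemma maximal_ratio_dominates:
  assumes n: "n > 0" and w: "w \<in> positive_vecs n" and v: "v \<in> positive_vecs n"
  obtains k c where "k < n" "c > 0" "v $ k = c * w $ k" "\<And>j. j < n \<Longrightarrow> v $ j \<le> c * w $ j"
proof -
  let ?q = "\<lambda>i. v $ i / w $ i"
  have fin: "finite (?q ` {..<n})" "?q ` {..<n} \<noteq> {}" using n by auto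
  obtain k where "k \<in> {..<n}" and max: "Max (?q ` {..<n}) = ?q k"
    using Max_in[OF fin] by blast
  then have k: "k < n" by simp
  have "v $ j \<le> ?q k * w $ j" if "j < n" for j
  proof -
    have "?q j \<le> ?q k" using Max_ge[OF fin(1), of "?q j"] max that by simp
    moreover have "w $ j > 0" using w that by (simp add: positive_vecs_def)
    ultimately show ?thesis by (simp add: pos_divide_le_eq)
  qed
  moreover have "v $ k > 0" "w $ k > 0"
    using v w k by (auto simp: positive_vecs_def)
  ultimately show ?thesis
    using that[of k "?q k"] k by simp
qed

lemma perron_eigenvalue_le:
  assumes A: "A \<in> carrier_mat n n" and n: "n > 0"
    and pos: "\<And>i j. i < n \<Longrightarrow> j < n \<Longrightarrow> A $$ (i, j) > 0"
    and w: "w \<in> positive_vecs n" "eigenvector A w r"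
    and v: "v \<in> positive_vecs n" "eigenvector A v t"
  shows "t \<le> r"
proof -
  obtain k c where k: "k < n" "c > 0" "v $ k = c * w $ k" "\<And>j. j < n \<Longrightarrow> v $ j \<le> c * w $ j"
    using maximal_ratio_dominates[OF n w(1) v(1)] by blast
  have "t * v $ k = (\<Sum>j<n. A $$ (k, j) * v $ j)"
    using eigenvector_row_sum[OF A v(2) k(1)] by simp
  also have "\<dots> \<le> (\<Sum>j<n. A $$ (k, j) * (c * w $ j))"
    using pos[OF k(1)] k(4) by (intro sum_mono mult_left_mono) (auto intro: less_imp_le)
  also have "\<dots> = c * (\<Sum>j<n. A $$ (k, j) * w $ j)"
    by (simp add: sum_distrib_left mult.left_commute)
  also have "\<dots> = r * v $ k"
    using eigenvector_row_sum[OF A w(2) k(1)] k(3) by simp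
  finally show ?thesis
    using v(1) k(1) by (simp add: positive_vecs_def)
qed

text \<open>
  Once the eigenvalues agree, row \<open>k\<close> of \<open>A (c w - v) = r (c w - v)\<close> is a vanishing sum of
  nonnegative terms with positive weights.
\<close>

lemma perron_vector_unique:
  assumes A: "A \<in> carrier_mat n n" and n: "n > 0"
    and pos: "\<And>i j. i < n \<Longrightarrow> j < n \<Longrightarrow> A $$ (i, j) > 0"
    and w: "perron_vector A w" and v: "perron_vector A v"
  shows "\<exists>c>0. v = c \<cdot>\<^sub>v w"
proof -
  have wp: "w \<in> positive_vecs n" and vp: "v \<in> positive_vecs n"
    using w v A by (auto simp: perron_vector_def)
  obtain r t where r: "eigenvector A w r" and t: "eigenvector A v t"
    using w v by (auto simp: perron_vector_def)
  have "t = r"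
    using perron_eigenvalue_le[OF A n pos wp r vp t] perron_eigenvalue_le[OF A n pos vp t wp r]
    by simp
  obtain k c where k: "k < n" "c > 0" "v $ k = c * w $ k" "\<And>j. j < n \<Longrightarrow> v $ j \<le> c * w $ j"
    using maximal_ratio_dominates[OF n wp vp] by blast
  have "(\<Sum>j<n. A $$ (k, j) * (c * w $ j - v $ j))
      = c * (\<Sum>j<n. A $$ (k, j) * w $ j) - (\<Sum>j<n. A $$ (k, j) * v $ j)"
    by (simp add: right_diff_distrib sum_subtractf sum_distrib_left mult.left_commute)
  also have "\<dots> = 0"
    using eigenvector_row_sum[OF A r k(1)] eigenvector_row_sum[OF A t k(1)] k(3) \<open>t = r\<close> by simp
  finally have "\<forall>j\<in>{..<n}. A $$ (k, j) * (c * w $ j - v $ j) = 0"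
    using pos[OF k(1)] k(4)
    by (subst (asm) sum_nonneg_eq_0_iff) (auto intro!: mult_nonneg_nonneg intro: less_imp_le)
  then have "v $ j = c * w $ j" if "j < n" for j
    using pos[OF k(1) that] that by force
  then have "v = c \<cdot>\<^sub>v w"
    using wp vp by (intro eq_vecI) (auto simp: positive_vecs_def)
  with k(2) show ?thesis by blast
qed

section \<open>The eigenvalue equation for the bordered matrix\<close>

text \<open>
  To the right of the largest pole the sum decreases from infinity while \<open>s\<close> grows, so the two
  sides cross.
\<close>

lemma exists_root_beyond_poles:
  fixes y :: "'a \<Rightarrow> real"
  assumes fin: "finite I" and ne: "I \<noteq> {}"
  obtains s where "\<And>i. i \<in> I \<Longrightarrow> y i < s + 1" "(\<Sum>i\<in>I. 1 / (s + 1 - y i)) = s"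
proof -
  define M where "M = Max (y ` I)"
  have le_M: "y i \<le> M" if "i \<in> I" for i
    using that fin by (simp add: M_def)
  have "M \<in> y ` I" unfolding M_def using fin ne by (intro Max_in) auto
  then obtain k where k: "k \<in> I" "y k = M" by auto
  define e where "e = 1 / (1 + \<bar>M\<bar>)"
  have e: "0 < e" "e \<le> 1" "1 / e = 1 + \<bar>M\<bar>"
    by (auto simp: e_def divide_simps)
  let ?g = "\<lambda>s. s - (\<Sum>i\<in>I. 1 / (s + 1 - y i))"
  let ?a = "M - 1 + e" and ?b = "\<bar>M\<bar> + real (card I)"
  have "\<exists>s\<ge>?a. s \<le> ?b \<and> ?g s = 0"
  proof (rule IVT')
    \<comment> \<open>At distance \<open>e\<close> from the largest pole its term alone, \<open>1 / e\<close>, outweighs \<open>s\<close>.\<close>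
    have "1 / e \<le> (\<Sum>i\<in>I. 1 / (?a + 1 - y i))"
      using member_le_sum[of k I "\<lambda>i. 1 / (?a + 1 - y i)"] k fin e(1) le_M
      by (force intro!: divide_nonneg_nonneg)
    then show "?g ?a \<le> 0" using e by linarith
    \<comment> \<open>At \<open>s \<ge> M\<close> every term is at most \<open>1\<close>.\<close>
    have "1 / (?b + 1 - y i) \<le> 1" if "i \<in> I" for i
    proof -
      have "1 \<le> ?b + 1 - y i"
        using le_M[OF that] abs_ge_self[of M] by linarith
      then show ?thesis by (simp add: divide_le_eq_1)
    qed
    then have "(\<Sum>i\<in>I. 1 / (?b + 1 - y i)) \<le> (\<Sum>i\<in>I. 1)"
      by (intro sum_mono) auto
    also have "\<dots> = real (card I)" by simp
    finally show "0 \<le> ?g ?b" by linarith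
    have "card I \<ge> 1" using fin ne by (simp add: Suc_le_eq card_gt_0_iff)
    then show "?a \<le> ?b" using e(2) by linarith
    have "s + 1 - y i \<noteq> 0" if "s \<ge> ?a" "i \<in> I" for s i
      using le_M[OF that(2)] that(1) e(1) by linarith
    then show "continuous_on {?a..?b} ?g"
      by (intro continuous_intros) auto
  qed
  then obtain s where s: "s \<ge> ?a" "?g s = 0" by blast
  show ?thesis
  proof (rule that[of s])
    show "y i < s + 1" if "i \<in> I" for i
      using le_M[OF that] s(1) e(1) by linarith
    show "(\<Sum>i\<in>I. 1 / (s + 1 - y i)) = s" using s(2) by linarith
  qed
qed

text \<open>
  A term is smaller than \<open>1\<close> exactly when \<open>y\<^sub>i < s\<close>. A root strictly above all \<open>y\<^sub>i\<close> would thus be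
  smaller than the number of terms, and a root strictly below all of them larger than it; but that
  number is itself one of the \<open>y\<^sub>i\<close>.
\<close>

lemma root_within_range:
  fixes y :: "'a \<Rightarrow> real"
  assumes fin: "finite I" and k: "k \<in> I" "y k = real (card I)"
    and below: "\<And>i. i \<in> I \<Longrightarrow> y i < s + 1"
    and root: "(\<Sum>i\<in>I. 1 / (s + 1 - y i)) = s"
  shows "\<exists>i\<in>I. s \<le> y i" and "\<exists>i\<in>I. y i \<le> s"
proof -
  have ne: "I \<noteq> {}" using k by auto
  show "\<exists>i\<in>I. s \<le> y i"
  proof (rule ccontr)
    assume "\<not> ?thesis"
    then have less: "\<And>i. i \<in> I \<Longrightarrow> y i < s" by force
    then have "(\<Sum>i\<in>I. 1 / (s + 1 - y i)) < (\<Sum>i\<in>I. 1)"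
      using fin ne below by (intro sum_strict_mono) auto
    then show False using root less[OF k(1)] k(2) by simp
  qed
  show "\<exists>i\<in>I. y i \<le> s"
  proof (rule ccontr)
    assume "\<not> ?thesis"
    then have greater: "\<And>i. i \<in> I \<Longrightarrow> s < y i" by force
    then have "(\<Sum>i\<in>I. 1) < (\<Sum>i\<in>I. 1 / (s + 1 - y i))"
      using fin ne below by (intro sum_strict_mono) auto
    then show False using root greater[OF k(1)] k(2) by simp
  qed
qed

section \<open>Bordering a reciprocal matrix\<close>

theorem theorem33:
  fixes n :: nat and B :: "real mat"
  assumes "n \<ge> 2"
    and "B \<in> reciprocal_mats (n - 1)"
  shows "\<exists>A \<in> reciprocal_mats n.
           mat_delete A (n - 1) (n - 1) = B \<and>
           (\<exists>w. perron_vector A w) \<and>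
           (\<forall>w. perron_vector A w \<longrightarrow> efficient A w)"
proof -
  define m where "m = n - 1"
  have n: "n = Suc m" and m: "m > 0" using assms(1) by (auto simp: m_def)
  have B: "B \<in> carrier_mat m m"
    and Bpos: "\<And>i j. i < m \<Longrightarrow> j < m \<Longrightarrow> B $$ (i, j) > 0"
    and Brec: "\<And>i j. i < m \<Longrightarrow> j < m \<Longrightarrow> B $$ (j, i) = 1 / B $$ (i, j)"
    using assms(2) unfolding m_def[symmetric] reciprocal_mats_def by blast+
  have Bdiag: "B $$ (i, i) = 1" if "i < m" for i
  proof -
    have "B $$ (i, i) * B $$ (i, i) = 1"
      using Brec[OF that that] Bpos[OF that that] by (simp add: field_simps)
    then show ?thesis
      using Bpos[OF that that] by (simp add: square_eq_1_iff)
  qed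

  define u where "u i = B $$ (i, 0)" for i
  define y where "y i = (\<Sum>j<m. B $$ (i, j) * u j) / u i" for i
  have upos: "u i > 0" if "i < m" for i using Bpos that m by (simp add: u_def)
  have u0: "u 0 = 1" using Bdiag m by (simp add: u_def)
  have "B $$ (0, j) * u j = 1" if "j < m" for j
    using Brec[OF that m] Bpos[OF that m] by (simp add: u_def)
  then have y0: "y 0 = real (card {..<m})" by (simp add: y_def u0)
  obtain s where below: "\<And>i. i \<in> {..<m} \<Longrightarrow> y i < s + 1"
    and root: "(\<Sum>i<m. 1 / (s + 1 - y i)) = s"
    using exists_root_beyond_poles[of "{..<m}" y] m by auto

  define x where "x i = (s + 1 - y i) * u i" for i
  have xpos: "x i > 0" if "i < m" for i using below upos that by (simp add: x_def)
  define A where "A = mat n n (\<lambda>(i, j).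
    if i < m then (if j < m then B $$ (i, j) else x i) else (if j < m then 1 / x j else 1))"
  define w where "w = vec n (\<lambda>i. if i < m then u i else 1)"
  have A: "A \<in> carrier_mat n n" and dimA: "dim_row A = n" by (auto simp: A_def)
  have A_entry: "A $$ (i, j) =
      (if i < m then (if j < m then B $$ (i, j) else x i) else (if j < m then 1 / x j else 1))"
    if "i < n" "j < n" for i j using that by (simp add: A_def)
  have Apos: "A $$ (i, j) > 0" if "i < n" "j < n" for i j
    using that Bpos xpos by (simp add: A_entry)
  have "A $$ (j, i) = 1 / A $$ (i, j)" if "i < n" "j < n" for i j
    using that Brec[of i j] by (simp add: A_entry)
  then have Arec: "A \<in> reciprocal_mats n"
    using A Apos unfolding reciprocal_mats_def by blast
  have del: "mat_delete A (n - 1) (n - 1) = B"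
    using B n by (intro eq_matI) (auto simp: mat_delete_def A_def)

  have w_entry: "w $ i = (if i < m then u i else 1)" if "i < n" for i
    using that by (simp add: w_def)
  have wpos: "w \<in> positive_vecs n"
    using upos by (auto simp: positive_vecs_def w_def)
  have "A *\<^sub>v w = (s + 1) \<cdot>\<^sub>v w"
  proof (rule eq_vecI)
    fix i
    assume "i < dim_vec ((s + 1) \<cdot>\<^sub>v w)"
    then have i: "i < n" by (simp add: w_def)
    have split: "(A *\<^sub>v w) $ i = (\<Sum>j<m. A $$ (i, j) * u j) + A $$ (i, m)"
      using i A n by (simp add: w_def scalar_prod_def atLeast0LessThan)
    show "(A *\<^sub>v w) $ i = ((s + 1) \<cdot>\<^sub>v w) $ i"
    proof (cases "i < m")
      case True
      have "(\<Sum>j<m. A $$ (i, j) * u j) = y i * u i"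
        using True n upos[OF True] by (simp add: A_entry y_def)
      then show ?thesis
        using True n split by (simp add: A_entry w_def x_def algebra_simps)
    next
      case False
      have "(\<Sum>j<m. A $$ (i, j) * u j) = (\<Sum>j<m. 1 / (s + 1 - y j))"
      proof (rule sum.cong)
        fix j
        assume "j \<in> {..<m}"
        then show "A $$ (i, j) * u j = 1 / (s + 1 - y j)"
          using False i n upos[of j] by (simp add: A_entry x_def)
      qed simp
      then show ?thesis
        using False i n split root by (simp add: A_entry w_def)
    qed
  qed (use A in \<open>simp add: w_def\<close>)
  moreover have "w \<noteq> 0\<^sub>v n"
  proof
    assume "w = 0\<^sub>v n"
    then have "w $ m = 0" using n by simp
    then show False using n by (simp add: w_def)
  qed
  ultimately have "eigenvector A w (s + 1)"
    by (simp add: eigenvector_def dimA w_def)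
  then have perron: "perron_vector A w"
    using wpos dimA by (auto simp: perron_vector_def)

  have eff: "efficient A w"
  proof (rule efficient_if_strongly_connected)
    show "w \<in> positive_vecs (dim_row A)" using wpos dimA by simp
    define E where
      "E = {(i, j). i < dim_row A \<and> j < dim_row A \<and> A $$ (i, j) \<le> w $ i / w $ j}"
    \<comment> \<open>On these pairs the ratios of \<open>w\<close> reproduce the matrix entries exactly.\<close>
    have star: "(i, 0) \<in> E" "(0, i) \<in> E" if "i < m" for i
      using that n m Brec[of i 0] by (auto simp: E_def dimA A_entry w_entry u0) (simp_all add: u_def)
    obtain p where "p < m" "s \<le> y p"
      using root_within_range(1)[OF _ _ y0 below root] m by auto
    then have into: "(p, m) \<in> E"
      using n upos[of p] by (auto simp: E_def dimA A_entry w_entry x_def)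
    obtain q where q: "q < m" "y q \<le> s"
      using root_within_range(2)[OF _ _ y0 below root] m by auto
    then have "u q \<le> x q"
      using upos[of q] by (simp add: x_def)
    then have out: "(m, q) \<in> E"
      using q n upos[of q] by (auto simp: E_def dimA A_entry w_entry intro!: divide_left_mono xpos)
    have hub: "(i, 0) \<in> E\<^sup>*" "(0, i) \<in> E\<^sup>*" if "i < n" for i
    proof -
      consider "i < m" | "i = m" using \<open>i < n\<close> n by linarith
      then have "(i, 0) \<in> E\<^sup>* \<and> (0, i) \<in> E\<^sup>*"
      proof cases
        case 1
        then show ?thesis using star by blast
      next
        case 2
        have "(m, 0) \<in> E\<^sup>*"
          using out star(1)[OF q(1)] by (meson converse_rtrancl_into_rtrancl r_into_rtrancl)
        moreover have "(0, m) \<in> E\<^sup>*"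
          using star(2)[OF \<open>p < m\<close>] into by (meson rtrancl_into_rtrancl r_into_rtrancl)
        ultimately show ?thesis using 2 by simp
      qed
      then show "(i, 0) \<in> E\<^sup>*" "(0, i) \<in> E\<^sup>*" by auto
    qed
    show "(i, j) \<in> {(i, j). i < dim_row A \<and> j < dim_row A \<and> A $$ (i, j) \<le> w $ i / w $ j}\<^sup>*"
      if "i < dim_row A" "j < dim_row A" for i j
      using hub(1)[of i] hub(2)[of j] that dimA unfolding E_def[symmetric]
      by (auto intro: rtrancl_trans)
  qed

  have "efficient A v" if "perron_vector A v" for v
  proof -
    obtain c where "c > 0" "v = c \<cdot>\<^sub>v w"
      using perron_vector_unique[OF A _ Apos perron \<open>perron_vector A v\<close>] n by auto
    then show ?thesis using efficient_smult[OF eff] by simp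
  qed
  with Arec del perron show ?thesis by blast
qed

end
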